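(* Let $\mu$ be a probability measure on $\mathbb Z^d$, let $\mathcal C$ be an open convex cone in $\mathbb R^d$ with vertex at the origin, let $E=\overline{\mathcal C}\cap\mathbb Z^d$ where $\overline{\mathcal C}$ is the closure of $\mathcal C$ in $\mathbb R^d$, and let $(X(t))$ be the substochastic random walk on $E$ with transition probabilities $p(x,y)=\mu(y-x)$, $x,y\in E$. Assume that: (1) $(X(t))$ is transient on $E$, and there are $\kappa>0$ and a finite set $\mathcal E_0\subset\mathbb Z^d$ such that $\mu(x)>0$ for all $x\in\mathcal E_0$ and for any $x\neq y$, $x,y\in E$, there is a sequence $x_0,x_1,\dots,x_n\in E$ with $x_0=x$, $x_n=y$, $n\le\kappa|y-x|$ and $x_j-x_{j-1}\in\mathcal E_0$ for all $j\in\{1,\dots,n\}$; (2) the jump generating function $R:\mathbb R^d\to\mathbb R\cup\{+\infty\}$, $R(\alpha)=\sum_{x\in\mathbb Z^d}\mu(x)e^{\langle\alpha,x\rangle}$, satisfies $R(\alpha)>R(0)=1$ for any $\alpha\in\mathbb R^d\setminus\{0\}$. Then for any $u\in E$, uniformly in $x\in E$, $$\lim_{n\to\infty}\frac1n\log Q(x,x+nu)=\lim_{n\to\infty}\frac1n\log Q(x+nu,x)=0 .$$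
   Context: $(X(t))$ is the homogeneous random walk on $\mathbb Z^d$ with step distribution $\mu$ killed upon its first exit from $E$; the killed state is denoted $\vartheta$ and $\tau_\vartheta=\inf\{t\ge1:X(t)=\vartheta\}$. Hitting probabilities: $Q(x,y)=\mathbb P_x(X(t)=y\text{ for some }0<t<\tau_\vartheta)$, $x,y\in E$. Transient on $E$ means $\sum_{t\ge0}\mathbb P_x(X(t)=y)<\infty$ for all $x,y\in E$. *)

theory Defs
  imports "HOL-Probability.Probability"
begin

definition real_vec :: "int ^ 'd \<Rightarrow> real ^ 'd" where
  "real_vec x = (\<chi> i. real_of_int (x $ i))"

text \<open>
  Cones are only required to be closed under multiplication by positive scalars: the library
  notions \<^const>\<open>cone\<close> and \<^const>\<open>conic\<close> also admit the scalar \<open>0\<close>, so that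
  the only nonempty open set satisfying them is the whole space.
\<close>
definition open_convex_cone :: "(real ^ 'd) set \<Rightarrow> bool" where
  "open_convex_cone C \<longleftrightarrow> open C \<and> convex C \<and> (\<forall>x\<in>C. \<forall>c>0. c *\<^sub>R x \<in> C)"

definition lattice_points :: "(real ^ 'd) set \<Rightarrow> (int ^ 'd) set" where
  "lattice_points C = {x. real_vec x \<in> closure C}"

text \<open>
  The law \<open>\<P>\<^sub>x\<close> is realised on the space of i.i.d. step sequences with distribution \<open>\<mu>\<close>;
  the dependence on the starting point \<open>x\<close> is put into the walk.
\<close>
definition steps :: "(int ^ 'd) pmf \<Rightarrow> (int ^ 'd) stream measure" where
  "steps \<mu> = stream_space (measure_pmf \<mu>)"

definition free_walk :: "int ^ 'd \<Rightarrow> nat \<Rightarrow> (int ^ 'd) stream \<Rightarrow> int ^ 'd" where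
  "free_walk x t \<omega> = x + (\<Sum>i<t. \<omega> !! i)"

text \<open>The killed state \<open>\<vartheta>\<close> is represented by \<^const>\<open>None\<close>.\<close>
definition killed_walk ::
  "(int ^ 'd) set \<Rightarrow> int ^ 'd \<Rightarrow> nat \<Rightarrow> (int ^ 'd) stream \<Rightarrow> (int ^ 'd) option" where
  "killed_walk E x t \<omega> =
     (if \<forall>s\<le>t. free_walk x s \<omega> \<in> E then Some (free_walk x t \<omega>) else None)"

definition killing_time :: "(int ^ 'd) set \<Rightarrow> int ^ 'd \<Rightarrow> (int ^ 'd) stream \<Rightarrow> enat" where
  "killing_time E x \<omega> = Inf {enat t |t. 1 \<le> t \<and> killed_walk E x t \<omega> = None}"

definition hitting_prob ::
  "(int ^ 'd) pmf \<Rightarrow> (int ^ 'd) set \<Rightarrow> int ^ 'd \<Rightarrow> int ^ 'd \<Rightarrow> real" where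
  "hitting_prob \<mu> E x y =
     \<P>(\<omega> in steps \<mu>. \<exists>t. 0 < t \<and> enat t < killing_time E x \<omega> \<and> killed_walk E x t \<omega> = Some y)"

definition transient_on :: "(int ^ 'd) pmf \<Rightarrow> (int ^ 'd) set \<Rightarrow> bool" where
  "transient_on \<mu> E \<longleftrightarrow>
     (\<forall>x\<in>E. \<forall>y\<in>E. summable (\<lambda>t. \<P>(\<omega> in steps \<mu>. killed_walk E x t \<omega> = Some y)))"

definition jump_gf :: "(int ^ 'd) pmf \<Rightarrow> real ^ 'd \<Rightarrow> ennreal" where
  "jump_gf \<mu> \<alpha> = (\<Sum>\<^sub>\<infinity>x. ennreal (pmf \<mu> x * exp (\<alpha> \<bullet> real_vec x)))"

end

theory Submission
  imports Defs
begin

text \<open>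
  The logarithms of the hitting probabilities are nonpositive, so only subexponential lower bounds are
  needed. Let \<open>f x\<close> be the supremum over \<open>t\<close> of the probability that the free walk goes
  from 0 to \<open>x\<close> in \<open>t\<close> steps. Since \<open>f\<close> is supermultiplicative, its decay rate
  \<open>A x = inf\<^sub>n (- ln (f (n x)) / n)\<close> is sublinear on the lattice. If \<open>A u > 0\<close>, then
  Hahn-Banach gives a linear functional \<open>\<alpha> \<le> A\<close> with \<open>\<alpha> u = A u\<close>, so that
  \<open>f x \<le> exp (- \<alpha> x)\<close>. The n-th power of the jump generating function at \<open>\<alpha>\<close>,
  restricted to finitely many steps, is then at most the number of reachable endpoints, which grows
  polynomially; hence \<open>R \<alpha> \<le> 1\<close>, a contradiction. So \<open>A = 0\<close>, and some finite set of
  paths from 0 to \<open>n\<^sub>0 u\<close> (or to \<open>- n\<^sub>0 u\<close>) has probability at least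
  \<open>exp (- \<epsilon> n\<^sub>0)\<close>. Shifted far enough into the cone these paths stay in \<open>E\<close>;
  repeating them and attaching boundedly many connecting paths gives the lower bounds for the walk
  started at 0, and translation by \<open>x \<in> E\<close> makes them uniform.
\<close>

section \<open>Bundles of paths\<close>

text \<open>Makes lists of lattice steps countable, so that the hitting event, a union of cylinders
  over paths, is measurable.\<close>

instance vec :: (countable, finite) countable
  by (rule countable_classI[of "\<lambda>x. to_nat (vec_nth x)"]) (simp add: vec_nth_inject)

text \<open>Paths are encoded by their increments: a translate keeps the same list, and a list can
  be compared with a prefix of the step stream.\<close>

fun path_in :: "'a::monoid_add set \<Rightarrow> 'a \<Rightarrow> 'a list \<Rightarrow> bool" where
  "path_in E x [] \<longleftrightarrow> x \<in> E"
| "path_in E x (a # l) \<longleftrightarrow> x \<in> E \<and> path_in E (x + a) l"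

lemma path_in_start: "path_in E x l \<Longrightarrow> x \<in> E"
  by (cases l) auto

lemma path_in_append:
  "path_in E x (l @ l') \<longleftrightarrow> path_in E x l \<and> path_in E (x + sum_list l) l'"
  by (induction l arbitrary: x) (auto simp: add.assoc dest: path_in_start)

lemma path_in_end: "path_in E x l \<Longrightarrow> x + sum_list l \<in> E"
  by (induction l arbitrary: x) (auto simp: add.assoc[symmetric])

lemma path_in_UNIV [simp]: "path_in UNIV x l"
  by (induction l arbitrary: x) auto

lemma path_in_translate:
  fixes x :: "'a::ab_group_add"
  assumes "path_in E x l" "\<And>y. y \<in> E \<Longrightarrow> z + y \<in> E'"
  shows "path_in E' (z + x) l"
  using assms(1)
proof (induction l arbitrary: x)
  case (Cons a l)
  then show ?case using Cons.IH[of "x + a"] assms(2)[of x] by (simp add: add.assoc)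
qed (simp add: assms(2))

definition path_weight :: "'a pmf \<Rightarrow> 'a list \<Rightarrow> real" where
  "path_weight \<mu> l = prod_list (map (pmf \<mu>) l)"

lemma path_weight_simps [simp]:
  "path_weight \<mu> [] = 1" "path_weight \<mu> (a # l) = pmf \<mu> a * path_weight \<mu> l"
  "path_weight \<mu> (l @ l') = path_weight \<mu> l * path_weight \<mu> l'"
  by (simp_all add: path_weight_def)

lemma path_weight_nonneg: "0 \<le> path_weight \<mu> l"
  by (induction l) auto

lemma path_weight_pos: "(\<And>a. a \<in> set l \<Longrightarrow> 0 < pmf \<mu> a) \<Longrightarrow> 0 < path_weight \<mu> l"
  by (induction l) auto

section \<open>Cylinder probabilities of the step stream\<close>

lemma prob_space_steps: "prob_space (steps \<mu>)"
  unfolding steps_def by (rule prob_space.prob_space_stream_space[OF prob_space_measure_pmf])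

lemma space_steps [simp]: "space (steps \<mu>) = UNIV"
  by (simp add: steps_def space_stream_space)

lemma sets_stake [measurable]: "{\<omega>. stake n \<omega> = l} \<in> sets (steps \<mu>)"
proof -
  have "sets (steps \<mu>) = sets (stream_space (count_space UNIV))"
    unfolding steps_def by (rule sets_stream_space_cong) simp
  moreover have "{\<omega> \<in> space (stream_space (count_space UNIV)). stake n \<omega> \<in> {l}}
      \<in> sets (stream_space (count_space UNIV))"
    by (rule measurable_sets_Collect[OF measurable_stake]) simp
  ultimately show ?thesis by (simp add: space_stream_space)
qed

text \<open>Induction on the list: the stream measure is integrated over its first step, and only
  the value \<open>a\<close> leaves a nonempty section, the cylinder of the tail.\<close>

lemma measure_stake:
  "measure (steps \<mu>) {\<omega>. stake (length l) \<omega> = l} = path_weight \<mu> l"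
proof (induction l)
  case Nil
  interpret prob_space "steps \<mu>" by (rule prob_space_steps)
  show ?case using prob_space by simp
next
  case (Cons a l)
  let ?N = "stream_space (measure_pmf \<mu>)"
  interpret S: prob_space "steps \<mu>" by (rule prob_space_steps)
  have "emeasure ?N {\<omega>. stake (length (a # l)) \<omega> = a # l}
      = (\<integral>\<^sup>+t. emeasure ?N {\<omega>\<in>space ?N. t ## \<omega> \<in> {\<omega>. stake (length (a # l)) \<omega> = a # l}} \<partial>measure_pmf \<mu>)"
    using sets_stake[of "length (a # l)" "a # l" \<mu>]
    by (intro prob_space.emeasure_stream_space[OF prob_space_measure_pmf]) (simp add: steps_def)
  also have "\<dots> = (\<integral>\<^sup>+t. ennreal (path_weight \<mu> l) * indicator {a} t \<partial>measure_pmf \<mu>)"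
  proof (rule nn_integral_cong)
    fix t
    have "{\<omega>\<in>space ?N. t ## \<omega> \<in> {\<omega>. stake (length (a # l)) \<omega> = a # l}}
        = (if t = a then {\<omega>. stake (length l) \<omega> = l} else {})"
      by (auto simp: space_stream_space)
    then show "emeasure ?N {\<omega>\<in>space ?N. t ## \<omega> \<in> {\<omega>. stake (length (a # l)) \<omega> = a # l}}
        = ennreal (path_weight \<mu> l) * indicator {a} t"
      using Cons.IH S.emeasure_eq_measure by (simp add: steps_def)
  qed
  also have "\<dots> = ennreal (path_weight \<mu> (a # l))"
    by (simp add: nn_integral_cmult emeasure_pmf_single ennreal_mult'' path_weight_nonneg mult.commute)
  finally show ?case
    using path_weight_nonneg[of \<mu> "a # l"] by (simp add: measure_def steps_def path_weight_nonneg)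
qed

lemma measure_stake_in:
  assumes "finite L" "\<And>l. l \<in> L \<Longrightarrow> length l = t"
  shows "measure (steps \<mu>) {\<omega>. stake t \<omega> \<in> L} = (\<Sum>l\<in>L. path_weight \<mu> l)"
proof -
  interpret prob_space "steps \<mu>" by (rule prob_space_steps)
  have "{\<omega>. stake t \<omega> \<in> L} = (\<Union>l\<in>L. {\<omega>. stake t \<omega> = l})" by auto
  then have "measure (steps \<mu>) {\<omega>. stake t \<omega> \<in> L} = (\<Sum>l\<in>L. measure (steps \<mu>) {\<omega>. stake t \<omega> = l})"
    by (simp only:) (rule finite_measure_finite_Union, auto simp: assms disjoint_family_on_def)
  also have "\<dots> = (\<Sum>l\<in>L. path_weight \<mu> l)"
    using assms(2) measure_stake[of \<mu>] by (intro sum.cong refl) fastforce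
  finally show ?thesis .
qed

lemma sum_path_weight_le_1:
  fixes \<mu> :: "(int ^ 'd) pmf"
  assumes "finite L" "\<And>l. l \<in> L \<Longrightarrow> length l = t"
  shows "(\<Sum>l\<in>L. path_weight \<mu> l) \<le> 1"
proof -
  interpret prob_space "steps \<mu>" by (rule prob_space_steps)
  show ?thesis using prob_le_1 measure_stake_in[OF assms, of \<mu>] by metis
qed

section \<open>Hitting events as unions of path cylinders\<close>

lemma free_walk_eq: "free_walk x t \<omega> = x + sum_list (stake t \<omega>)"
proof -
  have "(\<Sum>i<t. \<omega> !! i) = sum_list (stake t \<omega>)"
    by (induction t) (auto simp: stake_Suc simp del: stake.simps(2))
  then show ?thesis by (simp add: free_walk_def)
qed

lemma free_walk_in_iff: "(\<forall>s\<le>t. free_walk x s \<omega> \<in> E) \<longleftrightarrow> path_in E x (stake t \<omega>)"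
proof (induction t)
  case (Suc t)
  have "(\<forall>s\<le>Suc t. free_walk x s \<omega> \<in> E) \<longleftrightarrow>
      (\<forall>s\<le>t. free_walk x s \<omega> \<in> E) \<and> free_walk x (Suc t) \<omega> \<in> E"
    by (auto simp: le_Suc_eq)
  then show ?case using Suc
    by (auto simp: free_walk_eq stake_Suc path_in_append add.assoc path_in_end simp del: stake.simps(2))
qed (simp add: free_walk_eq)

text \<open>A walk alive at time \<open>t\<close> has all its positions up to \<open>t\<close> in
  \<open>E\<close>, so its killing time exceeds \<open>t\<close>. The event becomes a condition on
  the prefix of length \<open>t\<close>.\<close>

lemma killed_walk_hits_iff:
  "enat t < killing_time E x \<omega> \<and> killed_walk E x t \<omega> = Some y \<longleftrightarrow>
     path_in E x (stake t \<omega>) \<and> x + sum_list (stake t \<omega>) = y"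
proof -
  have "enat t < killing_time E x \<omega>" if *: "\<forall>s\<le>t. free_walk x s \<omega> \<in> E"
  proof -
    have "enat (Suc t) \<le> killing_time E x \<omega>"
      unfolding killing_time_def
    proof (rule Inf_greatest, clarify)
      fix s assume "killed_walk E x s \<omega> = None"
      then obtain r where "r \<le> s" "free_walk x r \<omega> \<notin> E"
        by (auto simp: killed_walk_def split: if_splits)
      with * have "t < r" by (meson not_le)
      with \<open>r \<le> s\<close> show "enat (Suc t) \<le> enat s" by simp
    qed
    then show ?thesis by (metis Suc_ile_eq)
  qed
  then show ?thesis
    by (auto simp: killed_walk_def free_walk_in_iff[symmetric] free_walk_eq[symmetric] split: if_splits)
qed

text \<open>The cylinders may overlap, since a path can return to \<open>y\<close>; hence
  \<open>hitting_prob_ge\<close> sums weights over one fixed length only.\<close>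

lemma hitting_prob_eq:
  "hitting_prob \<mu> E x y = measure (steps \<mu>)
     (\<Union>l\<in>{l. l \<noteq> [] \<and> path_in E x l \<and> x + sum_list l = y}. {\<omega>. stake (length l) \<omega> = l})"
proof -
  have "(\<exists>t>0. path_in E x (stake t \<omega>) \<and> x + sum_list (stake t \<omega>) = y) \<longleftrightarrow>
      (\<exists>l. (l \<noteq> [] \<and> path_in E x l \<and> x + sum_list l = y) \<and> stake (length l) \<omega> = l)"
    (is "?lhs \<longleftrightarrow> ?rhs") for \<omega>
  proof
    assume ?lhs
    then obtain t where "t > 0" "path_in E x (stake t \<omega>)" "x + sum_list (stake t \<omega>) = y"
      by blast
    then show ?rhs by (intro exI[of _ "stake t \<omega>"]) (auto simp: gr0_conv_Suc)
  next
    assume ?rhs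
    then obtain l where "l \<noteq> []" "path_in E x l" "x + sum_list l = y" "stake (length l) \<omega> = l"
      by blast
    then show ?lhs by (intro exI[of _ "length l"]) simp
  qed
  then show ?thesis
    unfolding hitting_prob_def killed_walk_hits_iff UN_simps by (simp add: UNION_eq)
qed

lemma hitting_prob_le_1: "hitting_prob \<mu> E x y \<le> 1"
  unfolding hitting_prob_def by (rule prob_space.prob_le_1[OF prob_space_steps])

lemma hitting_prob_ge:
  assumes "finite L" "0 < t" "\<And>l. l \<in> L \<Longrightarrow> length l = t \<and> path_in E x l \<and> x + sum_list l = y"
  shows "(\<Sum>l\<in>L. path_weight \<mu> l) \<le> hitting_prob \<mu> E x y"
proof -
  interpret prob_space "steps \<mu>" by (rule prob_space_steps)
  have "(\<Sum>l\<in>L. path_weight \<mu> l) = measure (steps \<mu>) {\<omega>. stake t \<omega> \<in> L}"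
    using assms by (intro measure_stake_in[symmetric]) auto
  also have "\<dots> \<le> hitting_prob \<mu> E x y"
    unfolding hitting_prob_eq
  proof (rule finite_measure_mono)
    show "{\<omega>. stake t \<omega> \<in> L} \<subseteq>
        (\<Union>l\<in>{l. l \<noteq> [] \<and> path_in E x l \<and> x + sum_list l = y}. {\<omega>. stake (length l) \<omega> = l})"
      using assms(2,3) by fastforce
  qed (auto intro!: sets.countable_UN'')
  finally show ?thesis .
qed

text \<open>A finite certificate that the walk is at \<open>y\<close> at time \<open>t\<close> with
  probability at least \<open>c\<close>. The common length makes cylinders disjoint and
  concatenation injective; finiteness lets one shift move all paths into the cone.\<close>

definition connects where
  "connects \<mu> E t x y c \<longleftrightarrow> (\<exists>L. finite L \<and>
     (\<forall>l\<in>L. length l = t \<and> path_in E x l \<and> x + sum_list l = y) \<and> c \<le> (\<Sum>l\<in>L. path_weight \<mu> l))"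

lemma connects_hitting_prob:
  assumes "connects \<mu> E t x y c" "0 < t"
  shows "c \<le> hitting_prob \<mu> E x y"
proof -
  obtain L where "finite L" "c \<le> (\<Sum>l\<in>L. path_weight \<mu> l)"
      "\<And>l. l \<in> L \<Longrightarrow> length l = t \<and> path_in E x l \<and> x + sum_list l = y"
    using assms(1) unfolding connects_def by blast
  with hitting_prob_ge[of L t E x y \<mu>] assms(2) show ?thesis by simp
qed

lemma connects_le_1: 
  fixes \<mu> :: "(int ^ 'd) pmf"
  assumes "connects \<mu> E t x y c"
  shows "c \<le> 1"
proof -
  obtain L where "finite L" "c \<le> (\<Sum>l\<in>L. path_weight \<mu> l)" "\<And>l. l \<in> L \<Longrightarrow> length l = t"
    using assms unfolding connects_def by blast
  with sum_path_weight_le_1[of L t \<mu>] show ?thesis by simp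
qed

lemma connects_path:
  "path_in E x l \<Longrightarrow> x + sum_list l = y \<Longrightarrow> connects \<mu> E (length l) x y (path_weight \<mu> l)"
  unfolding connects_def by (rule exI[of _ "{l}"]) simp

lemma connects_trans:
  assumes "connects \<mu> E s x y c" "connects \<mu> E t y z c'" "0 \<le> c" "0 \<le> c'"
  shows "connects \<mu> E (s + t) x z (c * c')"
proof -
  obtain L where L: "finite L" "c \<le> (\<Sum>l\<in>L. path_weight \<mu> l)"
      "\<And>l. l\<in>L \<Longrightarrow> length l = s \<and> path_in E x l \<and> x + sum_list l = y"
    using assms(1) unfolding connects_def by blast
  obtain L' where L': "finite L'" "c' \<le> (\<Sum>l\<in>L'. path_weight \<mu> l)"
      "\<And>l. l\<in>L' \<Longrightarrow> length l = t \<and> path_in E y l \<and> y + sum_list l = z"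
    using assms(2) unfolding connects_def by blast
  \<comment> \<open>All first factors have length \<open>s\<close>, so a concatenation splits
    uniquely.\<close>
  have inj: "inj_on (\<lambda>(l, l'). l @ l') (L \<times> L')"
    using L(3) L'(3) by (auto simp: inj_on_def)
  have "c * c' \<le> (\<Sum>l\<in>L. path_weight \<mu> l) * (\<Sum>l\<in>L'. path_weight \<mu> l)"
    using L(2) L'(2) assms(3,4) by (intro mult_mono) auto
  also have "\<dots> = (\<Sum>l\<in>(\<lambda>(l, l'). l @ l') ` (L \<times> L'). path_weight \<mu> l)"
    by (simp add: sum.reindex[OF inj] sum_product sum.cartesian_product)
        (simp add: case_prod_unfold)
  finally have "c * c' \<le> \<dots>" .
  moreover have "length l = s + t \<and> path_in E x l \<and> x + sum_list l = z"
    if "l \<in> (\<lambda>(l, l'). l @ l') ` (L \<times> L')" for l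
    using that L(3) L'(3) by (fastforce simp: path_in_append add.assoc[symmetric])
  ultimately show ?thesis
    unfolding connects_def using L(1) L'(1)
    by (intro exI[of _ "(\<lambda>(l, l'). l @ l') ` (L \<times> L')"]) auto
qed

lemma connects_power:
  assumes "\<And>k. k < m \<Longrightarrow> connects \<mu> E t (x k) (x (Suc k)) c" "0 \<le> c" "x 0 \<in> E"
  shows "connects \<mu> E (m * t) (x 0) (x m) (c ^ m)"
  using assms(1)
proof (induction m)
  case 0
  show ?case using connects_path[of E "x 0" "[]"] assms(3) by simp
next
  case (Suc m)
  then show ?case
    using connects_trans[of \<mu> E "m * t" "x 0" "x m" "c ^ m" t "x (Suc m)" c] assms(2)
    by (simp add: mult.commute add.commute)
qed

text \<open>Increments and weights are unchanged. This shifts bundles by points of the cone and,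
  with \<open>E' = UNIV\<close>, turns paths in the cone into free paths.\<close>

lemma connects_translate:
  fixes x :: "'a::ab_group_add"
  assumes "connects \<mu> E t x y c" "\<And>y. y \<in> E \<Longrightarrow> z + y \<in> E'"
  shows "connects \<mu> E' t (z + x) (z + y) c"
proof -
  obtain L where "finite L" "c \<le> (\<Sum>l\<in>L. path_weight \<mu> l)"
      "\<And>l. l\<in>L \<Longrightarrow> length l = t \<and> path_in E x l \<and> x + sum_list l = y"
    using assms(1) unfolding connects_def by blast
  then show ?thesis
    unfolding connects_def using path_in_translate[of E _ _ z E', OF _ assms(2)]
    by (intro exI[of _ L]) (auto simp: add.assoc)
qed

text \<open>Brings the communication hypothesis into the language of bundles: one path of steps with
  positive mass has positive weight.\<close>

lemma connects_of_walk:
  assumes "w 0 = x" "w n = y" "\<forall>j\<le>n. w j \<in> E" "\<forall>j\<in>{1..n}. w j - w (j - 1) \<in> E0"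
    "\<forall>z\<in>E0. 0 < pmf \<mu> z"
  obtains c where "0 < c" "connects \<mu> E n x (y::'a::ab_group_add) c"
proof -
  have "\<exists>l. length l = n \<and> set l \<subseteq> E0 \<and> path_in E x l \<and> x + sum_list l = y"
    using assms(1-4)
  proof (induction n arbitrary: y)
    case (Suc n)
    then obtain l where l: "length l = n" "set l \<subseteq> E0" "path_in E x l" "x + sum_list l = w n"
      by fastforce
    have "w (Suc n) - w n \<in> E0" "w (Suc n) \<in> E"
      using Suc.prems(3,4) by (auto dest: bspec[of _ _ "Suc n"])
    with l Suc.prems(2) show ?case
      by (intro exI[of _ "l @ [w (Suc n) - w n]"])
        (auto simp: path_in_append add.assoc[symmetric] dest: path_in_end)
  qed auto
  then obtain l where l: "length l = n" "set l \<subseteq> E0" "path_in E x l" "x + sum_list l = y"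
    by blast
  then show ?thesis
    using that[of "path_weight \<mu> l"] connects_path[of E x l y \<mu>] path_weight_pos[of l \<mu>] assms(5)
    by blast
qed

section \<open>Sublinear functions on the lattice\<close>

text \<open>Natural multiples replace the positive real scalars of the Hahn-Banach setting;
  \<open>p (- x)\<close> may differ from \<open>- p x\<close>.\<close>

definition sublinear :: "(int ^ 'd \<Rightarrow> real) \<Rightarrow> bool" where
  "sublinear p \<longleftrightarrow> (\<forall>x y. p (x + y) \<le> p x + p y) \<and> (\<forall>k x. p (int k *s x) = real k * p x)"

lemma sublinear_zero: "sublinear p \<Longrightarrow> p 0 = 0"
  by (metis (no_types, lifting) mult_zero_left of_nat_0 sublinear_def vector_smult_lzero)

lemma sublinear_minus:
  assumes "sublinear p"
  shows "- p (- x) \<le> p x"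
proof -
  have "p (x + - x) \<le> p x + p (- x)" using assms unfolding sublinear_def by blast
  then show ?thesis using sublinear_zero[OF assms] by simp
qed

text \<open>A Hahn-Banach step: moving \<open>k\<close> times along \<open>g\<close>, subtracting
  \<open>k * p g\<close> and taking the infimum over \<open>k\<close> closes the gap between
  \<open>p g\<close> and \<open>- p (- g)\<close>.\<close>

lemma sublinear_minorant_at:
  assumes "sublinear p"
  obtains p' where "sublinear p'" "\<And>x. p' x \<le> p x" "p' g = p g" "p' (- g) = - p g"
proof -
  have sub: "p (x + y) \<le> p x + p y" and scale: "p (int k *s x) = real k * p x" for x y k
    using assms by (auto simp: sublinear_def)
  define h where "h x k = p (x + int k *s g) - real k * p g" for x k
  define p' where "p' x = (INF k. h x k)" for x
  \<comment> \<open>A bound independent of \<open>k\<close>: adding \<open>- x\<close> turns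
    \<open>x + k g\<close> into \<open>k g\<close>, whose value is exactly
    \<open>k * p g\<close>.\<close>
  have lower: "- p (- x) \<le> h x k" for x k
    using sub[of "x + int k *s g" "- x"] scale[of k g] by (simp add: h_def)
  have bdd: "bdd_below (range (h x))" for x
    using lower by (auto simp: bdd_below_def)
  have p'_le: "p' x \<le> h x k" for x k
    unfolding p'_def by (rule cINF_lower[OF bdd]) simp
  have p'_ge: "c \<le> p' x" if "\<And>k. c \<le> h x k" for x c
    unfolding p'_def using that by (intro cINF_greatest) auto
  have h_add: "h (x + y) (j + k) \<le> h x j + h y k" for x y j k
    using sub[of "x + int j *s g" "y + int k *s g"]
    by (simp add: h_def algebra_simps vector_sadd_rdistrib)
  have p'_add: "p' (x + y) \<le> p' x + p' y" for x y
  proof -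
    have "p' (x + y) - h y k \<le> p' x" for k
      by (rule p'_ge) (use h_add p'_le in \<open>smt (verit)\<close>)
    then have "p' (x + y) - p' x \<le> p' y"
      by (intro p'_ge) (smt (verit))
    then show ?thesis by simp
  qed
  have p'_scale: "p' (int n *s x) = real n * p' x" for n x
  proof (cases "n = 0")
    case True
    have "h 0 k = 0" for k by (simp add: h_def scale)
    then show ?thesis using True by (simp add: p'_def)
  next
    case False
    have eq: "h (int n *s x) (n * k) = real n * h x k" for k
    proof -
      have "int n *s x + int (n * k) *s g = int n *s (x + int k *s g)"
        by (simp add: vector_add_ldistrib vector_smult_assoc)
      then have "p (int n *s x + int (n * k) *s g) = real n * p (x + int k *s g)"
        by (simp only: scale)
      then show ?thesis by (simp add: h_def right_diff_distrib)
    qed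
    \<comment> \<open>\<open>h y\<close> is decreasing, so the index \<open>n * k\<close> does at
      least as well as \<open>k\<close>; thus the infimum over multiples of \<open>n\<close> is the
      full infimum.\<close>
    have mono: "h y (j + k) \<le> h y j" for y j k
      using sub[of "y + int j *s g" "int k *s g"]
      by (simp add: h_def algebra_simps vector_sadd_rdistrib scale)
    show ?thesis
    proof (rule antisym)
      have "p' (int n *s x) / real n \<le> p' x"
      proof (rule p'_ge)
        fix k
        show "p' (int n *s x) / real n \<le> h x k"
          using p'_le[of "int n *s x" "n * k"] False unfolding eq by (simp add: field_simps)
      qed
      then show "p' (int n *s x) \<le> real n * p' x" using False by (simp add: field_simps)
    next
      show "real n * p' x \<le> p' (int n *s x)"
      proof (rule p'_ge)
        fix k
        have "real n * p' x \<le> real n * h x k" using p'_le by (intro mult_left_mono) auto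
        also have "\<dots> = h (int n *s x) (k + (n - 1) * k)"
          using False by (simp add: eq[symmetric] algebra_simps)
        also have "\<dots> \<le> h (int n *s x) k" by (rule mono)
        finally show "real n * p' x \<le> h (int n *s x) k" .
      qed
    qed
  qed
  have sl: "sublinear p'" using p'_add p'_scale by (simp add: sublinear_def)
  have "h g k = p g" for k
    using scale[of "Suc k" g] by (simp add: h_def algebra_simps vector_sadd_rdistrib)
  then have g: "p' g = p g" by (simp add: p'_def)
  have "p' (- g) \<le> - p g"
    using p'_le[of "- g" 1] sublinear_zero[OF assms] by (simp add: h_def)
  moreover have "- p g \<le> p' (- g)" using sublinear_minus[OF sl, of "-g"] g by simp
  ultimately have "p' (- g) = - p g" by simp
  moreover have "p' x \<le> p x" for x using p'_le[of x 0] by (simp add: h_def)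
  ultimately show ?thesis using that sl g by blast
qed

lemma sublinear_minorant_on:
  assumes "finite G" "sublinear p"
  shows "\<exists>p'. sublinear p' \<and> (\<forall>x. p' x \<le> p x) \<and> (\<forall>g\<in>G. p' (- g) = - p' g)"
  using assms(1)
proof (induction G)
  case (insert g G)
  then obtain p' where p': "sublinear p'" "\<And>x. p' x \<le> p x" "\<And>g. g \<in> G \<Longrightarrow> p' (- g) = - p' g"
    by blast
  obtain r where r: "sublinear r" "\<And>x. r x \<le> p' x" "r g = p' g" "r (- g) = - p' g"
    using sublinear_minorant_at[OF p'(1), of g] by blast
  \<comment> \<open>Linearity along earlier vectors survives: \<open>r e \<le> p' e\<close> and
    \<open>r (- e) \<le> - p' e\<close>, while \<open>- r (- e) \<le> r e\<close>.\<close>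
  have "r (- e) = - r e" if "e \<in> G" for e
    using r(2)[of e] r(2)[of "- e"] p'(3)[OF that] sublinear_minus[OF r(1), of e] by linarith
  then show ?case using r p'(2) by (metis insert_iff order_trans)
qed (use assms(2) in auto)

lemma real_vec_simps:
  "real_vec 0 = 0" "real_vec (x + y) = real_vec x + real_vec y" "real_vec (- x) = - real_vec x"
  "real_vec (k *s x) = real_of_int k *\<^sub>R real_vec x"
  by (simp_all add: real_vec_def vec_eq_iff)

text \<open>Hahn-Banach on the lattice: a sublinear function that is odd on the basis vectors is
  additive along the axes, hence an inner product. Treating \<open>u\<close> first fixes the value
  there, as later minorants are squeezed at \<open>u\<close> and \<open>- u\<close>.\<close>

lemma sublinear_support:
  fixes p :: "int ^ 'd \<Rightarrow> real"
  assumes "sublinear p"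
  obtains \<alpha> where "\<And>x. \<alpha> \<bullet> real_vec x \<le> p x" "\<alpha> \<bullet> real_vec u = p u"
proof -
  obtain p1 where p1: "sublinear p1" "\<And>x. p1 x \<le> p x" "p1 u = p u" "p1 (- u) = - p u"
    using sublinear_minorant_at[OF assms, of u] by blast
  obtain p2 where p2: "sublinear p2" "\<And>x. p2 x \<le> p1 x"
      "\<And>i. p2 (- axis i 1) = - p2 (axis i 1)"
    using sublinear_minorant_on[OF _ p1(1), of "range (\<lambda>i. axis i 1)"] by auto
  have sub: "p2 (x + y) \<le> p2 x + p2 y" and scale: "p2 (int k *s x) = real k * p2 x" for x y k
    using p2(1) by (auto simp: sublinear_def)
  have mult: "p2 (k *s axis i 1) = of_int k * p2 (axis i 1)" for k i
  proof (cases "k \<ge> 0")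
    case True
    then show ?thesis using scale[of "nat k"] by simp
  next
    case False
    have "k *s axis i 1 = int (nat (- k)) *s (- axis i 1)" using False by (simp add: vec_eq_iff)
    then show ?thesis using scale[of "nat (- k)" "- axis i 1"] False p2(3) by simp
  qed
  \<comment> \<open>The lower bound comes from returning to \<open>y\<close> by the opposite
    multiple.\<close>
  have add: "p2 (y + k *s axis i 1) = p2 y + of_int k * p2 (axis i 1)" for y k i
  proof -
    have "p2 (y + k *s axis i 1 + (- k) *s axis i 1) = p2 y"
      by (rule arg_cong[where f = p2]) (simp add: vec_eq_iff)
    then show ?thesis
      using sub[of y "k *s axis i 1"] sub[of "y + k *s axis i 1" "(- k) *s axis i 1"]
        mult[of k i] mult[of "- k" i] by simp
  qed
  have sum: "p2 (\<Sum>i\<in>I. (x $ i) *s axis i 1) = (\<Sum>i\<in>I. of_int (x $ i) * p2 (axis i 1))"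
    if "finite I" for x I
    using that
  proof (induction I)
    case empty
    then show ?case using sublinear_zero[OF p2(1)] by simp
  next
    case (insert i I)
    then show ?case using add[of "\<Sum>i\<in>I. (x $ i) *s axis i 1"] by (simp add: add.commute)
  qed
  define \<alpha> :: "real ^ 'd" where "\<alpha> = (\<chi> i. p2 (axis i 1))"
  have \<alpha>: "\<alpha> \<bullet> real_vec x = p2 x" for x
    using sum[of UNIV x] basis_expansion[of x]
    by (simp add: \<alpha>_def inner_vec_def real_vec_def mult.commute)
  have "p2 u = p u"
    using p2(2)[of u] p2(2)[of "- u"] p1(3,4) sublinear_minus[OF p2(1), of u] by linarith
  then show ?thesis using that \<alpha> p1(2) p2(2) by (metis order_trans)
qed

section \<open>Decay rate of the free walk\<close>

text \<open>Finite bundles exhaust the probability that the free walk from 0 is at \<open>x\<close>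
  at time \<open>t\<close>, so this is its supremum over \<open>t\<close>. Unlike a Green function
  it never exceeds 1.\<close>

definition free_prob :: "(int ^ 'd) pmf \<Rightarrow> int ^ 'd \<Rightarrow> real" where
  "free_prob \<mu> x = Sup {c. \<exists>t. connects \<mu> UNIV t 0 x c}"

lemma bdd_above_connects: "bdd_above {c. \<exists>t. connects \<mu> UNIV t 0 (x :: int ^ 'd) c}"
  using connects_le_1 by (fastforce simp: bdd_above_def)

lemma free_prob_ge: "connects \<mu> UNIV t 0 x c \<Longrightarrow> c \<le> free_prob \<mu> x"
  unfolding free_prob_def by (rule cSup_upper[OF _ bdd_above_connects]) auto

lemma connects_zero: "connects \<mu> E t x y 0"
  unfolding connects_def by (rule exI[of _ "{}"]) simp

lemma free_prob_approx:
  assumes "c < free_prob \<mu> x"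
  obtains t c' where "c < c'" "connects \<mu> UNIV t 0 x c'"
proof -
  have "connects \<mu> UNIV 0 0 x 0" by (rule connects_zero)
  then have "{c. \<exists>t. connects \<mu> UNIV t 0 x c} \<noteq> {}" by blast
  from less_cSupD[OF this assms[unfolded free_prob_def]] obtain c' t
    where "c < c'" "connects \<mu> UNIV t 0 x c'" by blast
  then show ?thesis by (rule that)
qed

lemma free_prob_le_1: "free_prob \<mu> x \<le> 1"
proof (rule ccontr)
  assume "\<not> free_prob \<mu> x \<le> 1"
  then have "1 < free_prob \<mu> x" by simp
  then obtain t c where "1 < c" "connects \<mu> UNIV t 0 x c" by (rule free_prob_approx)
  then show False using connects_le_1[of \<mu> UNIV t 0 x c] by simp
qed

lemma free_prob_nonneg: "0 \<le> free_prob \<mu> x"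
  by (rule free_prob_ge[OF connects_zero])

lemma ln_free_prob_le_0: "ln (free_prob \<mu> x) \<le> 0"
  using free_prob_nonneg[of \<mu> x] free_prob_le_1[of \<mu> x]
  \<comment> \<open>The case of probability zero relies on \<open>ln 0 = 0\<close>.\<close>
  by (cases "free_prob \<mu> x = 0") auto

text \<open>Near-optimal bundles are concatenated. As suprema need not be attained, the bound is
  shown for \<open>c\<close> and \<open>d\<close> strictly below them; then one factor at a time
  passes to its supremum.\<close>

lemma free_prob_add:
  assumes "0 < free_prob \<mu> x" "0 < free_prob \<mu> y"
  shows "free_prob \<mu> x * free_prob \<mu> y \<le> free_prob \<mu> (x + y)"
proof -
  have *: "c * d \<le> free_prob \<mu> (x + y)"
    if c: "0 < c" "c < free_prob \<mu> x" and d: "0 < d" "d < free_prob \<mu> y" for c d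
  proof -
    obtain s c' where c': "c < c'" "connects \<mu> UNIV s 0 x c'" using free_prob_approx[OF c(2)] by blast
    obtain t d' where d': "d < d'" "connects \<mu> UNIV t 0 y d'" using free_prob_approx[OF d(2)] by blast
    have "connects \<mu> UNIV t (x + 0) (x + y) d'" by (rule connects_translate[OF d'(2)]) auto
    then have "connects \<mu> UNIV (s + t) 0 (x + y) (c' * d')"
      using connects_trans[OF c'(2)] c d c'(1) d'(1) by simp
    then have "c' * d' \<le> free_prob \<mu> (x + y)" by (rule free_prob_ge)
    moreover have "c * d \<le> c' * d'" using c d c'(1) d'(1) by (intro mult_mono) auto
    ultimately show ?thesis by simp
  qed
  have "c * free_prob \<mu> y \<le> free_prob \<mu> (x + y)" if c: "0 < c" "c < free_prob \<mu> x" for c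
  proof -
    have "free_prob \<mu> y \<le> free_prob \<mu> (x + y) / c"
    proof (rule dense_le_bounded[OF assms(2)])
      fix d assume "0 < d" "d < free_prob \<mu> y"
      then show "d \<le> free_prob \<mu> (x + y) / c" using *[OF c, of d] c(1) by (simp add: pos_le_divide_eq mult.commute)
    qed
    then show ?thesis using c(1) by (simp add: field_simps)
  qed
  then have "free_prob \<mu> x \<le> free_prob \<mu> (x + y) / free_prob \<mu> y"
    using assms by (intro dense_le_bounded[OF assms(1)]) (simp add: field_simps)
  then show ?thesis using assms by (simp add: field_simps)
qed

text \<open>By Fekete's lemma the infimum is a limit.\<close>
definition decay_rate :: "(int ^ 'd) pmf \<Rightarrow> int ^ 'd \<Rightarrow> real" where
  "decay_rate \<mu> x = (INF n\<in>{1..}. - ln (free_prob \<mu> (int n *s x)) / real n)"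

lemma decay_rate_bdd:
  "bdd_below ((\<lambda>n. - ln (free_prob \<mu> (int n *s x)) / real n) ` {1..})"
proof -
  have "0 \<le> - ln (free_prob \<mu> (int n *s x)) / real n" for n
    using ln_free_prob_le_0 by (intro divide_nonneg_nonneg) (auto simp: le_minus_iff)
  then show ?thesis unfolding bdd_below_def by blast
qed

lemma decay_rate_le:
  "0 < n \<Longrightarrow> decay_rate \<mu> x \<le> - ln (free_prob \<mu> (int n *s x)) / real n"
  unfolding decay_rate_def by (rule cINF_lower[OF decay_rate_bdd]) simp

lemma decay_rate_ge:
  "(\<And>n. 0 < n \<Longrightarrow> c \<le> - ln (free_prob \<mu> (int n *s x)) / real n) \<Longrightarrow> c \<le> decay_rate \<mu> x"
  unfolding decay_rate_def by (rule cINF_greatest) auto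

text \<open>Positivity lets the logarithm turn supermultiplicativity of \<open>free_prob\<close>
  into subadditivity of \<open>q\<close>; the rest compares rates along common multiples.\<close>

lemma decay_rate_sublinear:
  assumes pos: "\<And>x. 0 < free_prob \<mu> x"
  shows "sublinear (decay_rate \<mu>)"
proof -
  define q where "q x = - ln (free_prob \<mu> x)" for x
  have q_add: "q (x + y) \<le> q x + q y" for x y
  proof -
    have "ln (free_prob \<mu> x * free_prob \<mu> y) \<le> ln (free_prob \<mu> (x + y))"
      using free_prob_add[OF pos pos] pos by (subst ln_le_cancel_iff) auto
    then show ?thesis using pos by (simp add: q_def ln_mult_pos)
  qed
  have "connects \<mu> UNIV 0 0 (0 :: int ^ 'a) 1"
    using connects_path[of UNIV 0 "[]" 0 \<mu>] by simp
  then have "free_prob \<mu> 0 = 1" using free_prob_ge free_prob_le_1 by (metis antisym)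
  then have q_0: "q 0 = 0" by (simp add: q_def)
  have q_mult: "q (int k *s x) \<le> real k * q x" for k x
  proof (induction k)
    case (Suc k)
    then show ?case using q_add[of x "int k *s x"] by (simp add: vector_sadd_rdistrib algebra_simps)
  qed (simp add: q_0)
  have A_le: "decay_rate \<mu> x \<le> q (int n *s x) / real n" if "0 < n" for x n
    using decay_rate_le[OF that] by (simp add: q_def)
  have A_ge: "c \<le> decay_rate \<mu> x" if "\<And>n. 0 < n \<Longrightarrow> c \<le> q (int n *s x) / real n" for x c
    using decay_rate_ge[of c \<mu> x] that by (simp add: q_def)
  have "decay_rate \<mu> (int k *s x) = real k * decay_rate \<mu> x" for k x
  proof (cases "k = 0")
    case True
    have "decay_rate \<mu> 0 \<le> 0" using A_le[of 1 0] q_0 by simp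
    moreover have "0 \<le> decay_rate \<mu> 0" by (rule A_ge) (simp add: q_0)
    ultimately show ?thesis using True by simp
  next
    case False
    show ?thesis
    proof (rule antisym)
      have "decay_rate \<mu> (int k *s x) / real k \<le> decay_rate \<mu> x"
      proof (rule A_ge)
        fix n :: nat assume n: "0 < n"
        have "decay_rate \<mu> (int k *s x) \<le> q (int n *s (int k *s x)) / real n" by (rule A_le[OF n])
        also have "q (int n *s (int k *s x)) = q (int k *s (int n *s x))"
          by (simp add: vector_smult_assoc mult.commute)
        also have "\<dots> / real n \<le> real k * q (int n *s x) / real n"
          by (rule divide_right_mono[OF q_mult]) simp
        finally show "decay_rate \<mu> (int k *s x) / real k \<le> q (int n *s x) / real n"
          using False by (simp add: field_simps)
      qed
      then show "decay_rate \<mu> (int k *s x) \<le> real k * decay_rate \<mu> x"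
        using False by (simp add: field_simps)
    next
      show "real k * decay_rate \<mu> x \<le> decay_rate \<mu> (int k *s x)"
      proof (rule A_ge)
        fix n :: nat assume n: "0 < n"
        \<comment> \<open>The \<open>n\<close>-th multiple of \<open>k x\<close> is the
          \<open>n * k\<close>-th multiple of \<open>x\<close>, one competitor in the infimum for
          \<open>x\<close>.\<close>
        show "real k * decay_rate \<mu> x \<le> q (int n *s (int k *s x)) / real n"
          using A_le[of "n * k" x] n False by (simp add: vector_smult_assoc field_simps)
      qed
    qed
  qed
  moreover have "decay_rate \<mu> (x + y) \<le> decay_rate \<mu> x + decay_rate \<mu> y" for x y
  proof -
    \<comment> \<open>The index \<open>n\<close> for \<open>x\<close> and the index \<open>m\<close>
      for \<open>y\<close> are brought to the common index \<open>n * m\<close>.\<close>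
    have *: "decay_rate \<mu> (x + y) \<le> q (int n *s x) / real n + q (int m *s y) / real m"
      if "0 < n" "0 < m" for n m
    proof -
      have "int (n * m) *s (x + y) = int m *s (int n *s x) + int n *s (int m *s y)"
        by (simp add: vector_smult_assoc vector_add_ldistrib mult.commute)
      then have "q (int (n * m) *s (x + y)) \<le> real m * q (int n *s x) + real n * q (int m *s y)"
        using q_add q_mult[of m "int n *s x"] q_mult[of n "int m *s y"] by (smt (verit))
      then have "q (int (n * m) *s (x + y)) / real (n * m)
          \<le> (real m * q (int n *s x) + real n * q (int m *s y)) / real (n * m)"
        by (rule divide_right_mono) simp
      also have "\<dots> = q (int n *s x) / real n + q (int m *s y) / real m"
        using that by (simp add: field_simps)
      finally show ?thesis using A_le[of "n * m" "x + y"] that by simp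
    qed
    have "decay_rate \<mu> (x + y) - q (int m *s y) / real m \<le> decay_rate \<mu> x" if "0 < m" for m
      by (rule A_ge) (use *[OF _ that] in \<open>simp add: algebra_simps\<close>)
    then have "decay_rate \<mu> (x + y) - decay_rate \<mu> x \<le> decay_rate \<mu> y"
      by (intro A_ge) (simp add: algebra_simps)
    then show ?thesis by simp
  qed
  ultimately show ?thesis by (simp add: sublinear_def)
qed

section \<open>Exponential moments and polynomial growth\<close>

lemma power_sum_exp_lists:
  assumes "finite B"
  shows "(\<Sum>a\<in>B. pmf \<mu> a * exp (\<alpha> \<bullet> real_vec a)) ^ n
    = (\<Sum>l\<in>{l. set l \<subseteq> B \<and> length l = n}. path_weight \<mu> l * exp (\<alpha> \<bullet> real_vec (sum_list l)))"
    (is "?s ^ n = (\<Sum>l\<in>?L n. ?g l)")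
proof (induction n)
  case 0
  have "?L 0 = {[]}" by auto
  then show ?case by (simp add: real_vec_simps)
next
  case (Suc n)
  \<comment> \<open>Distributivity prepends a letter to each word; the exponential of the endpoint
    is multiplicative over the steps.\<close>
  have "?s ^ Suc n = (\<Sum>a\<in>B. \<Sum>l\<in>?L n. ?g (a # l))"
    by (simp add: Suc sum_product real_vec_simps inner_add_right exp_add algebra_simps)
  also have "\<dots> = (\<Sum>x\<in>B \<times> ?L n. ?g (fst x # snd x))"
    by (simp add: sum.cartesian_product case_prod_unfold)
  also have "\<dots> = (\<Sum>l\<in>?L (Suc n). ?g l)"
    by (rule sum.reindex_bij_witness[of _ "\<lambda>l. (hd l, tl l)" "\<lambda>x. fst x # snd x"])
      (auto simp: length_Suc_conv)
  finally show ?case .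
qed

lemma card_int_box: "card {x :: int ^ 'd. \<forall>i. \<bar>x $ i\<bar> \<le> int N} = (2 * N + 1) ^ CARD('d)"
proof -
  have "bij_betw vec_nth {x :: int ^ 'd. \<forall>i. \<bar>x $ i\<bar> \<le> int N} (PiE UNIV (\<lambda>_. {- int N..int N}))"
    proof (rule bij_betwI[where g = vec_lambda])
    show "vec_lambda \<in> (PiE UNIV (\<lambda>_. {- int N..int N})) \<rightarrow> {x :: int ^ 'd. \<forall>i. \<bar>x $ i\<bar> \<le> int N}"
      by (auto simp: abs_le_iff PiE_iff minus_le_iff)
  qed (auto simp: abs_le_iff minus_le_iff)
  then have "card {x :: int ^ 'd. \<forall>i. \<bar>x $ i\<bar> \<le> int N} = card (PiE (UNIV :: 'd set) (\<lambda>_. {- int N..int N}))"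
    by (rule bij_betw_same_card)
  also have "\<dots> = card {- int N..int N} ^ CARD('d)"
    by (simp only: card_PiE finite prod_constant)
  also have "card {- int N..int N} = 2 * N + 1" unfolding card_atLeastAtMost_int by linarith
  finally show ?thesis .
qed

lemma sum_list_in_box:
  assumes "\<And>a i. a \<in> set l \<Longrightarrow> \<bar>a $ i\<bar> \<le> int K"
  shows "\<bar>sum_list l $ i\<bar> \<le> int (length l * K)"
  using assms
proof (induction l)
  case (Cons a l)
  have "\<bar>sum_list (a # l) $ i\<bar> \<le> \<bar>a $ i\<bar> + \<bar>sum_list l $ i\<bar>" by simp
  also have "\<dots> \<le> int K + int (length l * K)"
    using Cons by (intro add_mono) auto
  finally show ?case by simp
qed simp

text \<open>With \<open>x\<close> the \<open>d\<close>-th root of \<open>1 / s\<close>, taking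
  \<open>d\<close>-th roots reduces the claim to \<open>n * x ^ n\<close> tending to 0.\<close>

lemma polynomial_over_exponential:
  fixes a s :: real
  assumes "1 < s" "0 < d"
  shows "(\<lambda>n. (2 * (real n * a) + 1) ^ d / s ^ n) \<longlonglongrightarrow> 0"
proof -
  define x where "x = inverse (root d s)"
  have x: "0 < x" "x < 1" "inverse s = x ^ d"
    using assms by (simp_all add: x_def inverse_less_1_iff power_inverse)
  have "(\<lambda>n. 2 * a * (real n * x ^ n) + x ^ n) \<longlonglongrightarrow> 2 * a * 0 + 0"
    using x by (intro tendsto_intros powser_times_n_limit_0 LIMSEQ_power_zero) auto
  then have "(\<lambda>n. (2 * a * (real n * x ^ n) + x ^ n) ^ d) \<longlonglongrightarrow> (2 * a * 0 + 0) ^ d"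
    by (rule tendsto_power)
  moreover have "(2 * a * (real n * x ^ n) + x ^ n) ^ d = (2 * (real n * a) + 1) ^ d / s ^ n" for n
  proof -
    have "(2 * a * (real n * x ^ n) + x ^ n) ^ d = (2 * (real n * a) + 1) ^ d * (x ^ n) ^ d"
      by (simp add: power_mult_distrib[symmetric] algebra_simps)
    also have "(x ^ n) ^ d = inverse (s ^ n)"
      by (simp add: power_mult[symmetric] mult.commute power_inverse[symmetric] x(3))
    finally show ?thesis by (simp add: divide_inverse)
  qed
  ultimately show ?thesis using assms(2) by (simp add: zero_power)
qed

text \<open>The n-th power of the moment is at most the number of endpoints of n-step paths with steps
  in B, which is polynomial in n.\<close>
lemma exp_moment_le_1:
  fixes \<alpha> :: "real ^ 'd"
  assumes B: "finite B" and le: "\<And>x. free_prob \<mu> x * exp (\<alpha> \<bullet> real_vec x) \<le> 1"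
  shows "(\<Sum>a\<in>B. pmf \<mu> a * exp (\<alpha> \<bullet> real_vec a)) \<le> 1" (is "?s \<le> 1")
proof -
  obtain K where K: "\<And>a i. a \<in> B \<Longrightarrow> \<bar>a $ i\<bar> \<le> int K"
  proof
    fix a i assume "a \<in> B"
    have "nat \<bar>a $ i\<bar> \<le> (\<Sum>i\<in>UNIV. nat \<bar>a $ i\<bar>)" by (rule member_le_sum) auto
    also have "\<dots> \<le> (\<Sum>a\<in>B. \<Sum>i\<in>UNIV. nat \<bar>a $ i\<bar>)"
      using B \<open>a \<in> B\<close> by (intro member_le_sum[of a B "\<lambda>a. \<Sum>i\<in>UNIV. nat \<bar>a $ i\<bar>"]) auto
    finally show "\<bar>a $ i\<bar> \<le> int (\<Sum>a\<in>B. \<Sum>i\<in>UNIV. nat \<bar>a $ i\<bar>)" by linarith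
  qed
  have bound: "?s ^ n \<le> (2 * (real n * real K) + 1) ^ CARD('d)" for n
  proof -
    let ?L = "{l. set l \<subseteq> B \<and> length l = n}"
    let ?box = "{x :: int ^ 'd. \<forall>i. \<bar>x $ i\<bar> \<le> int (n * K)}"
    have L: "finite ?L" using finite_lists_length_eq[OF B] by simp
    \<comment> \<open>Steps have coordinates bounded by \<open>K\<close>, so \<open>n\<close> of
      them stay in a box of radius \<open>n * K\<close>, whose size is polynomial in
      \<open>n\<close>.\<close>
    have img: "sum_list ` ?L \<subseteq> ?box" using sum_list_in_box K by blast
    have box: "finite ?box" by (rule card_ge_0_finite) (simp add: card_int_box del: of_nat_mult)
    have "?s ^ n = (\<Sum>l\<in>?L. path_weight \<mu> l * exp (\<alpha> \<bullet> real_vec (sum_list l)))"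
      by (rule power_sum_exp_lists[OF B])
    also have "\<dots> = (\<Sum>x\<in>sum_list ` ?L. \<Sum>l\<in>{l \<in> ?L. sum_list l = x}. path_weight \<mu> l * exp (\<alpha> \<bullet> real_vec (sum_list l)))"
      by (rule sum.image_gen[OF L])
    also have "\<dots> \<le> (\<Sum>x\<in>sum_list ` ?L. 1)"
    proof (rule sum_mono)
      fix x
      \<comment> \<open>Words of length \<open>n\<close> ending at \<open>x\<close> form a bundle,
        so each endpoint contributes at most 1.\<close>
      have "connects \<mu> UNIV n 0 x (\<Sum>l\<in>{l \<in> ?L. sum_list l = x}. path_weight \<mu> l)"
        unfolding connects_def using L by (intro exI[of _ "{l \<in> ?L. sum_list l = x}"]) (auto intro: finite_subset[OF _ L])
      then have "(\<Sum>l\<in>{l \<in> ?L. sum_list l = x}. path_weight \<mu> l) * exp (\<alpha> \<bullet> real_vec x)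
          \<le> free_prob \<mu> x * exp (\<alpha> \<bullet> real_vec x)"
        by (intro mult_right_mono free_prob_ge) auto
      then show "(\<Sum>l\<in>{l \<in> ?L. sum_list l = x}. path_weight \<mu> l * exp (\<alpha> \<bullet> real_vec (sum_list l))) \<le> 1"
        using le[of x] by (simp add: sum_distrib_right)
    qed
    also have "\<dots> \<le> real (card ?box)"
      using card_mono[OF box img] by simp
    finally show ?thesis by (simp add: card_int_box add.commute del: of_nat_mult)
        (simp add: algebra_simps)
  qed
  show ?thesis
  proof (rule ccontr)
    assume "\<not> ?s \<le> 1"
    then have "1 < ?s" by simp
    from polynomial_over_exponential[OF this zero_less_card_finite]
    have "eventually (\<lambda>n. (2 * (real n * real K) + 1) ^ CARD('d) / ?s ^ n < 1) sequentially"
      by (rule order_tendstoD) simp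
    then obtain n where "(2 * (real n * real K) + 1) ^ CARD('d) / ?s ^ n < 1"
      using eventually_sequentially by auto
    with bound[of n] \<open>1 < ?s\<close> show False by (simp add: field_simps)
  qed
qed

lemma decay_rate_eq_0:
  fixes \<mu> :: "(int ^ 'd) pmf"
  assumes pos: "\<And>x. 0 < free_prob \<mu> x" and gf: "\<And>\<alpha>. \<alpha> \<noteq> 0 \<Longrightarrow> 1 < jump_gf \<mu> \<alpha>"
  shows "decay_rate \<mu> u = 0"
proof (rule ccontr)
  assume neq: "decay_rate \<mu> u \<noteq> 0"
  have "0 \<le> decay_rate \<mu> u"
    by (rule decay_rate_ge, intro divide_nonneg_nonneg) (use ln_free_prob_le_0 in \<open>auto simp: le_minus_iff\<close>)
  obtain \<alpha> where \<alpha>: "\<And>x. \<alpha> \<bullet> real_vec x \<le> decay_rate \<mu> x" "\<alpha> \<bullet> real_vec u = decay_rate \<mu> u"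
    using sublinear_support[OF decay_rate_sublinear[OF pos]] by blast
  have "free_prob \<mu> x * exp (\<alpha> \<bullet> real_vec x) \<le> 1" for x
  proof -
    \<comment> \<open>The competitor \<open>n = 1\<close> bounds the decay rate by
      \<open>- ln (free_prob \<mu> x)\<close>.\<close>
    have "\<alpha> \<bullet> real_vec x \<le> - ln (free_prob \<mu> x)"
      using \<alpha>(1)[of x] decay_rate_le[of 1 \<mu> x] by simp
    then have "exp (\<alpha> \<bullet> real_vec x) \<le> inverse (free_prob \<mu> x)"
      using pos[of x] by (metis exp_le_cancel_iff exp_ln exp_minus)
    then show ?thesis using pos[of x] by (simp add: field_simps)
  qed
  then have le: "(\<Sum>a\<in>B. pmf \<mu> a * exp (\<alpha> \<bullet> real_vec a)) \<le> 1" if "finite B" for B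
    using exp_moment_le_1 that by blast
  have "jump_gf \<mu> \<alpha> \<le> 1"
    unfolding jump_gf_def
    by (rule infsum_le_finite_sums) (auto simp: nonneg_summable_on_complete le sum_ennreal ennreal_le_1)
  moreover have "\<alpha> \<noteq> 0" using \<alpha>(2) neq by auto
  ultimately show False using gf[of \<alpha>] by simp
qed

text \<open>A zero infimum has an index \<open>n\<close> with rate below \<epsilon>; strictness
  leaves room to replace the supremum in \<open>free_prob\<close> by an actual finite
  bundle.\<close>

lemma free_prob_subexponential:
  assumes pos: "\<And>x. 0 < free_prob \<mu> x" and rate: "decay_rate \<mu> u = 0" and "0 < \<epsilon>"
  obtains n t c where "0 < n" "exp (- \<epsilon> * real n) \<le> c" "connects \<mu> UNIV t 0 (int n *s u) c"
proof -
  have "\<exists>n>0. - ln (free_prob \<mu> (int n *s u)) / real n < \<epsilon>"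
  proof (rule ccontr)
    assume "\<not> ?thesis"
    then have "\<epsilon> \<le> decay_rate \<mu> u" by (intro decay_rate_ge) (meson not_le)
    with rate \<open>0 < \<epsilon>\<close> show False by simp
  qed
  then obtain n where n: "0 < n" "- ln (free_prob \<mu> (int n *s u)) / real n < \<epsilon>" by blast
  then have "- \<epsilon> * real n < ln (free_prob \<mu> (int n *s u))" by (simp add: field_simps)
  then have "exp (- \<epsilon> * real n) < free_prob \<mu> (int n *s u)"
    using pos by (metis exp_less_cancel_iff exp_ln)
  then obtain t c where "exp (- \<epsilon> * real n) < c" "connects \<mu> UNIV t 0 (int n *s u) c"
    by (rule free_prob_approx)
  with n(1) show ?thesis by (intro that) auto
qed

section \<open>Walks in the cone\<close>

text \<open>Midpoints scaled by 2 show that \<open>C\<close> is closed under sums; a sum of closures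
  lies in the closure of the sum.\<close>

lemma closure_cone_add:
  assumes "open_convex_cone C" "x \<in> closure C" "y \<in> closure C"
  shows "x + y \<in> closure C"
proof -
  have "a + b \<in> C" if "a \<in> C" "b \<in> C" for a b
  proof -
    have "(1/2) *\<^sub>R a + (1/2) *\<^sub>R b \<in> C"
      using assms(1) that unfolding open_convex_cone_def by (intro convexD) auto
    then have "2 *\<^sub>R ((1/2) *\<^sub>R a + (1/2) *\<^sub>R b) \<in> C"
      using assms(1) unfolding open_convex_cone_def by (metis zero_less_numeral)
    then show ?thesis by (simp add: scaleR_add_right)
  qed
  then have "C + C \<subseteq> C" by (auto simp: set_plus_def)
  moreover have "x + y \<in> closure C + closure C" using assms(2,3) by (rule set_plus_intro)
  ultimately show ?thesis using closure_sum closure_mono by blast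
qed

lemma lattice_points_add:
  "open_convex_cone C \<Longrightarrow> x \<in> lattice_points C \<Longrightarrow> y \<in> lattice_points C \<Longrightarrow> x + y \<in> lattice_points C"
  by (simp add: lattice_points_def real_vec_simps closure_cone_add)

text \<open>The vertex may lie outside \<open>C\<close>, but it is the limit of shrinking multiples
  of a point of \<open>C\<close>.\<close>

lemma zero_in_lattice_points:
  assumes "open_convex_cone C" "C \<noteq> {}"
  shows "0 \<in> lattice_points C"
proof -
  obtain c where c: "c \<in> C" using assms(2) by blast
  have "(\<lambda>n. (1 / real (Suc n)) *\<^sub>R c) \<longlonglongrightarrow> 0 *\<^sub>R c"
    by (intro tendsto_intros LIMSEQ_inverse_real_of_nat[unfolded inverse_eq_divide])
  moreover have "(1 / real (Suc n)) *\<^sub>R c \<in> C" for n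
    using assms(1) c unfolding open_convex_cone_def by auto
  ultimately have "0 *\<^sub>R c \<in> closure C"
    unfolding closure_sequential by (intro exI[of _ "\<lambda>n. (1 / real (Suc n)) *\<^sub>R c"]) simp
  then show ?thesis by (simp add: lattice_points_def real_vec_simps)
qed

lemma lattice_points_scale:
  assumes "open_convex_cone C" "x \<in> lattice_points C"
  shows "int n *s x \<in> lattice_points C"
proof (induction n)
  case 0
  have "C \<noteq> {}" using assms(2) by (auto simp: lattice_points_def)
  then show ?case using zero_in_lattice_points[OF assms(1)] by simp
next
  case (Suc n)
  then show ?case using lattice_points_add[OF assms(1,2)]
    by (simp add: vector_sadd_rdistrib)
qed

text \<open>Rounding \<open>n * c\<close> down and dividing by \<open>n\<close> gives rational
  points converging to \<open>c\<close>. They enter the open set \<open>C - {0}\<close>, and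
  clearing the denominator stays in the cone.\<close>

lemma cone_lattice_vector:
  assumes "open_convex_cone C" "C \<noteq> {}"
  obtains w where "w \<noteq> 0" "real_vec w \<in> C"
proof -
  have "open C" using assms(1) by (simp add: open_convex_cone_def)
  obtain c where c: "c \<in> C" "c \<noteq> 0"
    using not_open_singleton[of "0 :: real ^ 'a"] \<open>open C\<close> assms(2) by (metis empty_iff insertI1 subset_singletonD subsetI singletonD insertE)
  define f where "f n = (\<chi> i. \<lfloor>real n * c $ i\<rfloor>)" for n
  have "(\<lambda>n. (1 / real n) *\<^sub>R real_vec (f n)) \<longlonglongrightarrow> c"
  proof (rule vec_tendstoI)
    fix i
    have "(\<lambda>n. of_int \<lfloor>real n * c $ i\<rfloor> / real n) \<longlonglongrightarrow> c $ i"
    proof (rule real_tendsto_sandwich)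
      show "eventually (\<lambda>n. c $ i - 1 / real n \<le> of_int \<lfloor>real n * c $ i\<rfloor> / real n) sequentially"
        using eventually_gt_at_top[of 0]
      proof eventually_elim
        case (elim n)
        have "real n * c $ i - 1 \<le> of_int \<lfloor>real n * c $ i\<rfloor>" by linarith
        then have "(real n * c $ i - 1) / real n \<le> of_int \<lfloor>real n * c $ i\<rfloor> / real n"
          by (rule divide_right_mono) simp
        then show ?case using elim by (simp add: diff_divide_distrib)
      qed
      show "eventually (\<lambda>n. of_int \<lfloor>real n * c $ i\<rfloor> / real n \<le> c $ i) sequentially"
        using eventually_gt_at_top[of 0]
      proof eventually_elim
        case (elim n)
        then show ?case by (simp add: divide_le_eq mult.commute)
      qed
      have "(\<lambda>n. c $ i - 1 / real n) \<longlonglongrightarrow> c $ i - 0" by (intro tendsto_intros lim_1_over_n)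
      then show "(\<lambda>n. c $ i - 1 / real n) \<longlonglongrightarrow> c $ i" by simp
    qed simp
    then show "(\<lambda>n. ((1 / real n) *\<^sub>R real_vec (f n)) $ i) \<longlonglongrightarrow> c $ i"
      by (simp add: f_def real_vec_def)
  qed
  then have "eventually (\<lambda>n. (1 / real n) *\<^sub>R real_vec (f n) \<in> C - {0}) sequentially"
    using \<open>open C\<close> c by (intro topological_tendstoD) auto
  then have "eventually (\<lambda>n. 0 < n \<and> (1 / real n) *\<^sub>R real_vec (f n) \<in> C - {0}) sequentially"
    using eventually_gt_at_top by (rule eventually_conj[rotated])
  then obtain n where n: "0 < n" "(1 / real n) *\<^sub>R real_vec (f n) \<in> C - {0}"
    by (auto simp: eventually_sequentially)
  then have "real n *\<^sub>R ((1 / real n) *\<^sub>R real_vec (f n)) \<in> C"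
    using assms(1) unfolding open_convex_cone_def by (metis DiffD1 of_nat_0_less_iff)
  then have "real_vec (f n) \<in> C" using n(1) by simp
  moreover have "f n \<noteq> 0" using n(2) by (auto simp: real_vec_simps)
  ultimately show ?thesis using that by blast
qed

text \<open>Divided by \<open>M\<close>, the point becomes \<open>w + p / M\<close>, which tends to
  the interior point \<open>w\<close>.\<close>

lemma eventually_shift_in_cone:
  assumes "open_convex_cone C" "real_vec w \<in> C"
  shows "eventually (\<lambda>M. int M *s w + p \<in> lattice_points C) sequentially"
proof -
  have "(\<lambda>M. real_vec w + (1 / real M) *\<^sub>R real_vec p) \<longlonglongrightarrow> real_vec w + 0 *\<^sub>R real_vec p"
    by (intro tendsto_intros lim_1_over_n)
  then have "eventually (\<lambda>M. real_vec w + (1 / real M) *\<^sub>R real_vec p \<in> C) sequentially"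
    using assms by (intro topological_tendstoD) (auto simp: open_convex_cone_def)
  then show ?thesis
    using eventually_gt_at_top[of 0]
  proof eventually_elim
    case (elim M)
    then have "real M *\<^sub>R (real_vec w + (1 / real M) *\<^sub>R real_vec p) \<in> C"
      using assms(1) unfolding open_convex_cone_def by auto
    then have "real_vec (int M *s w + p) \<in> C"
      using elim by (simp add: real_vec_simps scaleR_add_right)
    then show ?case using closure_subset by (auto simp: lattice_points_def)
  qed
qed

text \<open>Finitely many paths visit finitely many points, so one threshold for \<open>M\<close>
  serves all of them.\<close>

lemma eventually_shifted_connects:
  assumes C: "open_convex_cone C" "real_vec w \<in> C" and "connects \<mu> UNIV t 0 x c"
  shows "eventually (\<lambda>M. connects \<mu> (lattice_points C) t (int M *s w) (int M *s w + x) c) sequentially"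
proof -
  obtain L where L: "finite L" "c \<le> (\<Sum>l\<in>L. path_weight \<mu> l)"
      "\<And>l. l\<in>L \<Longrightarrow> length l = t \<and> sum_list l = x"
    using assms(3) unfolding connects_def by auto
  have "eventually (\<lambda>M. path_in (lattice_points C) (int M *s w + p) l) sequentially" for p l
  proof (induction l arbitrary: p)
    case (Cons a l)
    then show ?case
      using eventually_conj[OF eventually_shift_in_cone[OF C, of p] Cons.IH[of "p + a"]]
      by (simp add: add.assoc)
  qed (simp add: eventually_shift_in_cone[OF C])
  from this[of 0] have "eventually (\<lambda>M. \<forall>l\<in>L. path_in (lattice_points C) (int M *s w) l) sequentially"
    using L(1) by (intro eventually_ball_finite) auto
  then show ?thesis
  proof eventually_elim
    case (elim M)
    then show ?case unfolding connects_def using L by blast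
  qed
qed

section \<open>Subexponential lower bounds for the hitting probabilities\<close>

lemma connects_mono:
  assumes "connects \<mu> E t x y c" "c' \<le> c"
  shows "connects \<mu> E t x y c'"
  using assms(1) order_trans[OF assms(2)] unfolding connects_def by blast

text \<open>Hitting requires a positive time; this excludes the empty path on the leg from 0 to
  \<open>e\<close>.\<close>

lemma connects_length_pos:
  assumes "connects \<mu> E t x y c" "0 < c" "x \<noteq> y"
  shows "0 < t"
proof (rule ccontr)
  assume "\<not> 0 < t"
  obtain L where "finite L" "c \<le> (\<Sum>l\<in>L. path_weight \<mu> l)"
      "\<And>l. l\<in>L \<Longrightarrow> length l = t \<and> x + sum_list l = y"
    using assms(1) unfolding connects_def by blast
  moreover from this have "L = {}" using \<open>\<not> 0 < t\<close> assms(3) by fastforce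
  ultimately show False using assms(2) by simp
qed

text \<open>The walk first moves away from the boundary by e, follows m copies of a bundle of free paths
  there, and finally descends to y.\<close>
lemma hitting_prob_ge_blocks:
  assumes add: "\<And>x y. x \<in> E \<Longrightarrow> y \<in> E \<Longrightarrow> x + y \<in> E"
    and z: "\<And>k. k \<le> m \<Longrightarrow> z k \<in> E" "\<And>k. k < m \<Longrightarrow> z (Suc k) = z k + b" and e: "e \<in> E"
    and conn: "connects \<mu> E s 0 e c\<^sub>1" "connects \<mu> E t e (e + b) c" "connects \<mu> E t' (z m + e) y c\<^sub>2"
    and pos: "0 < s" "0 \<le> c\<^sub>1" "0 \<le> c" "0 \<le> c\<^sub>2"
  shows "c\<^sub>1 * c ^ m * c\<^sub>2 \<le> hitting_prob \<mu> E (z 0) y"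
proof -
  \<comment> \<open>Translation by a point of \<open>E\<close> keeps paths in \<open>E\<close>; the
    blocks are moved by \<open>z k\<close> in the same way.\<close>
  have "connects \<mu> E s (z 0 + 0) (z 0 + e) c\<^sub>1"
    by (rule connects_translate[OF conn(1) add]) (use z in auto)
  moreover have "connects \<mu> E (m * t) (z 0 + e) (z m + e) (c ^ m)"
  proof (rule connects_power[where x = "\<lambda>k. z k + e"])
    fix k assume "k < m"
    then have "connects \<mu> E t (z k + e) (z k + (e + b)) c"
      by (intro connects_translate[OF conn(2) add]) (use z in auto)
    then show "connects \<mu> E t (z k + e) (z (Suc k) + e) c"
      using z(2)[OF \<open>k < m\<close>] by (simp add: algebra_simps)
  qed (use pos add z e in auto)
  ultimately have "connects \<mu> E (s + m * t + t') (z 0) y (c\<^sub>1 * c ^ m * c\<^sub>2)"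
    using conn(3) pos by (auto intro!: connects_trans)
  then show ?thesis by (rule connects_hitting_prob) (use pos in simp)
qed

text \<open>Serves the finitely many remainders modulo the block length; the constant is a minimum,
  while the time may vary.\<close>

lemma connects_uniform:
  assumes "finite A" and "\<And>a. a \<in> A \<Longrightarrow> \<exists>t c. 0 < c \<and> connects \<mu> E t (f a) (g a) c"
  obtains c where "0 < c" "\<And>a. a \<in> A \<Longrightarrow> \<exists>t. connects \<mu> E t (f a) (g a) c"
proof -
  have "\<exists>c>0. \<forall>a\<in>A. \<exists>t. connects \<mu> E t (f a) (g a) c"
    using assms
  proof (induction A)
    case empty
    then show ?case by (intro exI[of _ 1]) auto
  next
    case (insert a A)
    obtain c where c: "0 < c" "\<forall>a\<in>A. \<exists>t. connects \<mu> E t (f a) (g a) c"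
      using insert by (metis insertCI)
    obtain t d where d: "0 < d" "connects \<mu> E t (f a) (g a) d"
      using insert.prems[of a] by auto
    have "\<exists>t. connects \<mu> E t (f i) (g i) (min c d)" if "i \<in> insert a A" for i
      using that c(2) d(2) connects_mono min.cobounded1 min.cobounded2 by (metis insertE)
    with c(1) d(1) show ?case by (intro exI[of _ "min c d"]) simp
  qed
  then show ?thesis using that by blast
qed

text \<open>The \<open>m\<close> complete blocks cover at most \<open>n\<close> units, so together
  they cost no more than rate \<epsilon> over \<open>n\<close>.\<close>

lemma exp_power_ge:
  assumes "exp (- \<epsilon> * real k) \<le> c" "0 < \<epsilon>" "m * k \<le> n"
  shows "exp (- \<epsilon> * real n) \<le> c ^ m"
proof -
  have "real m * real k \<le> real n" using assms(3) by (metis of_nat_le_iff of_nat_mult)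
  then have "exp (- \<epsilon> * real n) \<le> exp (- \<epsilon> * real k) ^ m"
    using assms(2) by (simp add: exp_of_nat_mult[symmetric] mult.left_commute mult.commute)
  also have "\<dots> \<le> c ^ m" using assms(1) by (intro power_mono) auto
  finally show ?thesis .
qed

text \<open>Initial and final legs are built from finitely many bundles and translated by
  \<open>x\<close>, so \<delta>, which absorbs them, depends on neither \<open>x\<close> nor
  \<open>n\<close>; the blocks account for the exponential.\<close>

lemma hitting_prob_subexponential:
  fixes \<mu> :: "(int ^ 'd) pmf"
  assumes cone: "open_convex_cone C" and E: "E = lattice_points C"
    and irr: "\<And>x y. x \<in> E \<Longrightarrow> y \<in> E \<Longrightarrow> \<exists>t c. 0 < c \<and> connects \<mu> E t x y c"
    and gf: "\<And>\<alpha>. \<alpha> \<noteq> 0 \<Longrightarrow> 1 < jump_gf \<mu> \<alpha>"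
    and u: "u \<in> E" and "0 < \<epsilon>"
  obtains \<delta> where "0 < \<delta>"
    "\<And>n x. x \<in> E \<Longrightarrow> \<delta> * exp (- \<epsilon> * real n) \<le> hitting_prob \<mu> E x (x + int n *s u)"
    "\<And>n x. x \<in> E \<Longrightarrow> \<delta> * exp (- \<epsilon> * real n) \<le> hitting_prob \<mu> E (x + int n *s u) x"
proof -
  have add: "x + y \<in> E" if "x \<in> E" "y \<in> E" for x y using that lattice_points_add[OF cone] E by simp
  have scale: "int n *s x \<in> E" if "x \<in> E" for n x using that lattice_points_scale[OF cone] E by simp
  have "C \<noteq> {}" using u by (auto simp: E lattice_points_def)
  from cone_lattice_vector[OF cone this] obtain w where w: "w \<noteq> 0" "real_vec w \<in> C" by blast
  have "0 \<in> E" using zero_in_lattice_points[OF cone \<open>C \<noteq> {}\<close>] E by simp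
  have "w \<in> E" using w closure_subset by (auto simp: E lattice_points_def)
  \<comment> \<open>Two points deep in the cone that differ by \<open>x\<close> are connected there,
    and the bundle is translated back to 0.\<close>
  have free_pos: "0 < free_prob \<mu> x" for x
  proof -
    obtain M where M: "int M *s w + x \<in> E"
      using eventually_shift_in_cone[OF cone w(2), of x] unfolding E eventually_sequentially by blast
    obtain t c where c: "0 < c" "connects \<mu> E t (int M *s w) (int M *s w + x) c"
      using irr[OF scale[OF \<open>w \<in> E\<close>] M] by blast
    have "connects \<mu> UNIV t (- (int M *s w) + int M *s w) (- (int M *s w) + (int M *s w + x)) c"
      by (rule connects_translate[OF c(2)]) simp
    then have "c \<le> free_prob \<mu> x" using free_prob_ge[of \<mu> t x c] by (simp add: add.assoc[symmetric])
    then show ?thesis using c(1) by simp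
  qed
  \<comment> \<open>Stated for all \<open>v\<close> because it is applied to \<open>u\<close> and
    \<open>- u\<close>; the latter may lie outside \<open>E\<close>.\<close>
  have free_paths: "\<exists>k t c. 0 < k \<and> exp (- \<epsilon> * real k) \<le> c \<and> connects \<mu> UNIV t 0 (int k *s v) c" for v
    using free_prob_subexponential[OF free_pos decay_rate_eq_0[OF free_pos gf] \<open>0 < \<epsilon>\<close>] by metis
  obtain k t c where k: "0 < k" "exp (- \<epsilon> * real k) \<le> c" "connects \<mu> UNIV t 0 (int k *s u) c"
    using free_paths[of u] by blast
  obtain k' t' c' where k': "0 < k'" "exp (- \<epsilon> * real k') \<le> c'"
      "connects \<mu> UNIV t' 0 (int k' *s (- u)) c'"
    using free_paths[of "- u"] by blast
  have cpos: "0 \<le> c" "0 \<le> c'" using k(2) k'(2) exp_ge_zero order_trans by blast+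
  \<comment> \<open>One height \<open>M\<close> serves both directions; \<open>0 < M\<close> makes
    \<open>e\<close> nonzero.\<close>
  have "eventually (\<lambda>M. 0 < M \<and> connects \<mu> E t (int M *s w) (int M *s w + int k *s u) c \<and>
      connects \<mu> E t' (int M *s w) (int M *s w + int k' *s (- u)) c') sequentially"
    unfolding E
    by (intro eventually_conj eventually_gt_at_top eventually_shifted_connects cone w k k')
  then obtain M where M: "0 < M" "connects \<mu> E t (int M *s w) (int M *s w + int k *s u) c"
      "connects \<mu> E t' (int M *s w) (int M *s w + int k' *s (- u)) c'"
    unfolding eventually_sequentially by blast
  define e where "e = int M *s w"
  have e: "e \<in> E" "e \<noteq> 0"
    using w(1) M(1) scale[OF \<open>w \<in> E\<close>] by (auto simp: e_def vec_eq_iff)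
  obtain s c\<^sub>1 where s: "0 < c\<^sub>1" "connects \<mu> E s 0 e c\<^sub>1" using irr[OF \<open>0 \<in> E\<close> e(1)] by blast
  have "0 < s" using connects_length_pos[OF s(2,1)] e(2) by simp
  \<comment> \<open>The remainder \<open>r\<close> of \<open>n\<close> is settled by the final leg:
    forward from \<open>e\<close> to \<open>r u\<close>, backward from \<open>r u + e\<close> to
    0.\<close>
  obtain c\<^sub>2 where c2: "0 < c\<^sub>2" "\<And>r. r \<in> {..<k} \<Longrightarrow> \<exists>t. connects \<mu> E t e (int r *s u) c\<^sub>2"
    using connects_uniform[of "{..<k}" \<mu> E "\<lambda>_. e" "\<lambda>r. int r *s u"] irr[OF e(1) scale[OF u]]
    by blast
  obtain c\<^sub>3 where c3: "0 < c\<^sub>3" "\<And>r. r \<in> {..<k'} \<Longrightarrow> \<exists>t. connects \<mu> E t (int r *s u + e) 0 c\<^sub>3"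
    using connects_uniform[of "{..<k'}" \<mu> E "\<lambda>r. int r *s u + e" "\<lambda>_. 0"]
      irr[OF add[OF scale[OF u] e(1)] \<open>0 \<in> E\<close>]
    by blast
  define \<delta> where "\<delta> = c\<^sub>1 * min c\<^sub>2 c\<^sub>3"
  have forward: "\<delta> * exp (- \<epsilon> * real n) \<le> hitting_prob \<mu> E x (x + int n *s u)" if "x \<in> E" for n x
  proof -
    define m where "m = n div k"
    have n: "n = m * k + n mod k" by (simp add: m_def)
    have mem: "x + int j *s u \<in> E" for j by (intro add that scale u)
    obtain t2 where "connects \<mu> E t2 e (int (n mod k) *s u) c\<^sub>2" using c2(2)[of "n mod k"] k(1) by auto
    then have "connects \<mu> E t2 (x + int (m * k) *s u + e) (x + int (m * k) *s u + int (n mod k) *s u) c\<^sub>2"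
      by (rule connects_translate) (intro add that scale u)
    also have "x + int (m * k) *s u + int (n mod k) *s u = x + int n *s u"
      using vector_sadd_rdistrib[of "int (m * k)" "int (n mod k)" u]
      by (simp only: add.assoc of_nat_add[symmetric] n[symmetric])
    finally have "c\<^sub>1 * c ^ m * c\<^sub>2 \<le> hitting_prob \<mu> E (x + int (0 * k) *s u) (x + int n *s u)"
      using \<open>0 < s\<close> s c2(1) cpos M(2)
      by (intro hitting_prob_ge_blocks[where z = "\<lambda>i. x + int (i * k) *s u" and b = "int k *s u" and e = e])
        (auto simp: e_def[symmetric] e mem add vector_sadd_rdistrib distrib_right simp del: of_nat_mult)
    moreover have "\<delta> * exp (- \<epsilon> * real n) \<le> c\<^sub>1 * c\<^sub>2 * c ^ m"
      unfolding \<delta>_def using s(1) c2(1) c3(1) cpos exp_power_ge[OF k(2) \<open>0 < \<epsilon>\<close>, of m n] n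
      by (intro mult_mono) auto
    ultimately show ?thesis by (simp add: mult_ac)
  qed
  have backward: "\<delta> * exp (- \<epsilon> * real n) \<le> hitting_prob \<mu> E (x + int n *s u) x" if "x \<in> E" for n x
  proof -
    define m where "m = n div k'"
    have n: "n = m * k' + n mod k'" by (simp add: m_def)
    have mem: "x + int j *s u \<in> E" for j by (intro add that scale u)
    \<comment> \<open>Natural subtraction is exact here: \<open>i < m\<close> gives
      \<open>Suc i * k' \<le> n\<close>.\<close>
    have step: "int (n - Suc i * k') *s u = int (n - i * k') *s u + int k' *s (- u)" if "i < m" for i
    proof -
      have "Suc i * k' \<le> m * k'" using that by (intro mult_le_mono1) simp
      then have "Suc i * k' \<le> n" using n by linarith
      then have "n - i * k' = n - Suc i * k' + k'" by simp
      then show ?thesis by (simp only: of_nat_add vector_sadd_rdistrib) (simp add: vec_eq_iff)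
    qed
    obtain t2 where "connects \<mu> E t2 (int (n mod k') *s u + e) 0 c\<^sub>3" using c3(2)[of "n mod k'"] k'(1) by auto
    then have "connects \<mu> E t2 (x + (int (n mod k') *s u + e)) (x + 0) c\<^sub>3"
      by (rule connects_translate) (intro add that)
    moreover have "n mod k' = n - m * k'" by (simp add: m_def minus_div_mult_eq_mod)
    ultimately have "connects \<mu> E t2 (x + int (n - m * k') *s u + e) x c\<^sub>3"
      by (simp only: add.assoc add_0_right)
    then have "c\<^sub>1 * c' ^ m * c\<^sub>3 \<le> hitting_prob \<mu> E (x + int (n - 0 * k') *s u) x"
      using \<open>0 < s\<close> s c3(1) cpos M(3)
      by (intro hitting_prob_ge_blocks[where z = "\<lambda>i. x + int (n - i * k') *s u"
            and b = "int k' *s (- u)" and e = e])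
        (auto simp: e_def[symmetric] e mem step add simp del: of_nat_mult mult_Suc)
    moreover have "\<delta> * exp (- \<epsilon> * real n) \<le> c\<^sub>1 * c\<^sub>3 * c' ^ m"
      unfolding \<delta>_def using s(1) c2(1) c3(1) cpos exp_power_ge[OF k'(2) \<open>0 < \<epsilon>\<close>, of m n] n
      by (intro mult_mono) auto
    ultimately show ?thesis by (simp add: mult_ac)
  qed
  show ?thesis by (rule that[OF _ forward backward]) (simp_all add: \<delta>_def s(1) c2(1) c3(1))
qed

text \<open>The logarithm lies between \<open>ln \<delta> - \<epsilon> * n\<close> and 0 with
  \<delta> independent of \<open>x\<close>; division by \<open>n\<close> makes the constant
  vanish.\<close>

lemma uniform_limit_ln_over_n:
  fixes q :: "nat \<Rightarrow> 'a \<Rightarrow> real"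
  assumes le: "\<And>n x. q n x \<le> 1"
    and ge: "\<And>\<epsilon>. 0 < \<epsilon> \<Longrightarrow> \<exists>\<delta>>0. \<forall>n. \<forall>x\<in>E. \<delta> * exp (- \<epsilon> * real n) \<le> q n x"
  shows "uniform_limit E (\<lambda>n x. 1 / real n * ln (q n x)) (\<lambda>_. 0) sequentially"
proof (rule uniform_limitI)
  fix \<epsilon> :: real assume "0 < \<epsilon>"
  \<comment> \<open>Half of \<epsilon> pays for the exponential rate, the other half for
    \<open>ln \<delta> / n\<close>.\<close>
  then obtain \<delta> where \<delta>: "0 < \<delta>" "\<And>n x. x \<in> E \<Longrightarrow> \<delta> * exp (- (\<epsilon> / 2) * real n) \<le> q n x"
    using ge[of "\<epsilon> / 2"] by auto
  have "(\<lambda>n. ln \<delta> * (1 / real n)) \<longlonglongrightarrow> ln \<delta> * 0" by (intro tendsto_intros lim_1_over_n)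
  then have "eventually (\<lambda>n. - (\<epsilon> / 2) < ln \<delta> * (1 / real n)) sequentially"
    by (rule order_tendstoD) (use \<open>0 < \<epsilon>\<close> in simp)
  then show "\<forall>\<^sub>F n in sequentially. \<forall>x\<in>E. dist (1 / real n * ln (q n x)) 0 < \<epsilon>"
    using eventually_gt_at_top[of 0]
  proof eventually_elim
    case (elim n)
    show ?case
    proof
      fix x assume "x \<in> E"
      have "0 < \<delta> * exp (- (\<epsilon> / 2) * real n)" using \<delta>(1) by simp
      then have q: "0 < q n x" using \<delta>(2)[OF \<open>x \<in> E\<close>, of n] by linarith
      have "ln (\<delta> * exp (- (\<epsilon> / 2) * real n)) \<le> ln (q n x)"
        using q \<delta> \<open>x \<in> E\<close> by (subst ln_le_cancel_iff) auto
      then have "ln \<delta> - \<epsilon> / 2 * real n \<le> ln (q n x)" using \<delta>(1) by (simp add: ln_mult_pos)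
      then have "(ln \<delta> - \<epsilon> / 2 * real n) / real n \<le> ln (q n x) / real n"
        by (rule divide_right_mono) simp
      then have "ln \<delta> * (1 / real n) - \<epsilon> / 2 \<le> ln (q n x) / real n"
        using elim(2) by (simp add: diff_divide_distrib)
      moreover have "ln (q n x) / real n \<le> 0"
        using q le[of n x] by (intro divide_nonpos_nonneg) auto
      ultimately show "dist (1 / real n * ln (q n x)) 0 < \<epsilon>" using elim(1) by (simp add: dist_real_def)
    qed
  qed
qed

theorem proposition4p1:
  fixes \<mu> :: "(int ^ 'd) pmf" and C :: "(real ^ 'd) set" and E :: "(int ^ 'd) set"
    and u :: "int ^ 'd"
  assumes cone: "open_convex_cone C"
    and E: "E = lattice_points C"
    and transient: "transient_on \<mu> E"
    and communication: "\<exists>(\<kappa>::real) E0. 0 < \<kappa> \<and> finite E0 \<and> (\<forall>z\<in>E0. 0 < pmf \<mu> z) \<and>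
      (\<forall>x\<in>E. \<forall>y\<in>E. x \<noteq> y \<longrightarrow>
        (\<exists>n (w :: nat \<Rightarrow> int ^ 'd). w 0 = x \<and> w n = y \<and> (\<forall>j\<le>n. w j \<in> E) \<and>
          real n \<le> \<kappa> * norm (real_vec (y - x)) \<and> (\<forall>j\<in>{1..n}. w j - w (j - 1) \<in> E0)))"
    and jump_gf: "jump_gf \<mu> 0 = 1" "\<forall>\<alpha>. \<alpha> \<noteq> 0 \<longrightarrow> jump_gf \<mu> 0 < jump_gf \<mu> \<alpha>"
    and u: "u \<in> E"
  shows \<comment> \<open>As \<open>ln 0 = 0\<close> in HOL, finiteness of the logarithms is asserted explicitly.\<close>
    "(\<forall>\<^sub>F n in sequentially. \<forall>x\<in>E.
        0 < hitting_prob \<mu> E x (x + int n *s u) \<and> 0 < hitting_prob \<mu> E (x + int n *s u) x) \<and>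
     uniform_limit E (\<lambda>n x. 1 / real n * ln (hitting_prob \<mu> E x (x + int n *s u)))
       (\<lambda>_. 0) sequentially \<and>
     uniform_limit E (\<lambda>n x. 1 / real n * ln (hitting_prob \<mu> E (x + int n *s u) x))
       (\<lambda>_. 0) sequentially"
proof -
  obtain \<kappa> :: real and E0 where E0: "\<forall>z\<in>E0. 0 < pmf \<mu> z"
    and walk: "\<forall>x\<in>E. \<forall>y\<in>E. x \<noteq> y \<longrightarrow>
      (\<exists>n (w :: nat \<Rightarrow> int ^ 'd). w 0 = x \<and> w n = y \<and> (\<forall>j\<le>n. w j \<in> E) \<and>
        real n \<le> \<kappa> * norm (real_vec (y - x)) \<and> (\<forall>j\<in>{1..n}. w j - w (j - 1) \<in> E0))"
    using communication by (elim exE conjE)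
  have irr: "\<exists>t c. 0 < c \<and> connects \<mu> E t x y c" if "x \<in> E" "y \<in> E" for x y
  \<comment> \<open>The communication hypothesis concerns distinct points; the empty path, of weight
    1, joins a point to itself.\<close>
  proof (cases "x = y")
    case True
    then show ?thesis using connects_path[of E x "[]" y \<mu>] that by (auto intro: zero_less_one)
  next
    case False
    from walk[rule_format, OF that this] obtain n :: nat and w where "w 0 = x" "w n = y" "\<forall>j\<le>n. w j \<in> E"
      "\<forall>j\<in>{1..n}. w j - w (j - 1) \<in> E0" by blast
    from connects_of_walk[OF this E0] show ?thesis by blast
  qed
  have lower: "\<exists>\<delta>>0. (\<forall>n. \<forall>x\<in>E. \<delta> * exp (- \<epsilon> * real n) \<le> hitting_prob \<mu> E x (x + int n *s u)) \<and>
      (\<forall>n. \<forall>x\<in>E. \<delta> * exp (- \<epsilon> * real n) \<le> hitting_prob \<mu> E (x + int n *s u) x)" if "0 < \<epsilon>" for \<epsilon>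
  proof (rule hitting_prob_subexponential[OF cone E irr _ u that])
    show "1 < jump_gf \<mu> \<alpha>" if "\<alpha> \<noteq> 0" for \<alpha> using jump_gf that by simp
  qed blast+
  \<comment> \<open>Rate 1 already yields positivity for every \<open>n\<close>, hence genuine
    logarithms.\<close>
  obtain \<delta> where \<delta>: "0 < \<delta>"
    "\<And>n x. x \<in> E \<Longrightarrow> \<delta> * exp (- 1 * real n) \<le> hitting_prob \<mu> E x (x + int n *s u)"
    "\<And>n x. x \<in> E \<Longrightarrow> \<delta> * exp (- 1 * real n) \<le> hitting_prob \<mu> E (x + int n *s u) x"
    using lower[of 1] by auto
  have "0 < \<delta> * exp (- 1 * real n)" for n using \<delta>(1) by simp
  then have "\<forall>x\<in>E. 0 < hitting_prob \<mu> E x (x + int n *s u) \<and> 0 < hitting_prob \<mu> E (x + int n *s u) x" for n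
    using \<delta>(2,3) by (meson less_le_trans)
  moreover have "uniform_limit E (\<lambda>n x. 1 / real n * ln (hitting_prob \<mu> E x (x + int n *s u))) (\<lambda>_. 0) sequentially"
    using lower hitting_prob_le_1[of \<mu> E] uniform_limit_ln_over_n[of "\<lambda>n x. hitting_prob \<mu> E x (x + int n *s u)" E]
    by meson
  moreover have "uniform_limit E (\<lambda>n x. 1 / real n * ln (hitting_prob \<mu> E (x + int n *s u) x)) (\<lambda>_. 0) sequentially"
    using lower hitting_prob_le_1[of \<mu> E] uniform_limit_ln_over_n[of "\<lambda>n x. hitting_prob \<mu> E (x + int n *s u) x" E]
    by meson
  ultimately show ?thesis by simp
qed

end
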